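(* For integers $m\ge 2$ and $n\ge 3m+2$, $R_{\pi}(K_{1,n},B_m)=n$.
   Context: All graphs are finite and simple. For graphs $F,G,H$, write $F\rightarrow(G,H)$ if every red-blue coloring of the edges of $F$ contains a red copy of $G$ or a blue copy of $H$. The Ramsey number $R(G,H)$ is the smallest $r$ with $K_r\rightarrow(G,H)$. $K_r\setminus P_k$ denotes $K_r$ with the edges of a path on $k$ vertices ($k\le r$) deleted. The path-critical Ramsey number is $R_{\pi}(G,H)=\max\{k: K_r\setminus P_k\rightarrow(G,H)\}$ where $r=R(G,H)$. $K_{1,n}$ is the star with $n$ leaves, and $B_m=K_2+mK_1$ is the book graph: $m$ vertices each joined to both ends of an edge (here $G+H$ denotes the join of disjoint $G$ and $H$, and $mK_1$ is $m$ isolated vertices). *)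

theory Defs
  imports "HOL-Library.Ramsey"
begin

text \<open>A graph is a pair of a vertex set and a set of two-element subsets of it.\<close>

type_synonym 'a graph = "'a set \<times> 'a set set"

abbreviation verts :: "'a graph \<Rightarrow> 'a set" where "verts \<equiv> fst"
abbreviation edges :: "'a graph \<Rightarrow> 'a set set" where "edges \<equiv> snd"

definition simple_graph :: "'a graph \<Rightarrow> bool" where
  "simple_graph G \<longleftrightarrow> finite (verts G) \<and> edges G \<subseteq> [verts G]\<^bsup>2\<^esup>"

text \<open>Copies are subgraphs, not necessarily induced.\<close>

definition contains_copy :: "'a graph \<Rightarrow> 'b graph \<Rightarrow> bool" where
  "contains_copy F G \<longleftrightarrow>
     (\<exists>f. inj_on f (verts G) \<and> f ` verts G \<subseteq> verts F \<and> (\<forall>e\<in>edges G. f ` e \<in> edges F))"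

datatype colour = Red | Blue

definition colour_graph :: "'a graph \<Rightarrow> ('a set \<Rightarrow> colour) \<Rightarrow> colour \<Rightarrow> 'a graph" where
  "colour_graph F c x = (verts F, {e \<in> edges F. c e = x})"

definition arrows :: "'a graph \<Rightarrow> 'b graph \<Rightarrow> 'c graph \<Rightarrow> bool" where
  "arrows F G H \<longleftrightarrow>
     (\<forall>c. contains_copy (colour_graph F c Red) G \<or> contains_copy (colour_graph F c Blue) H)"

definition complete_graph :: "nat \<Rightarrow> nat graph" where
  "complete_graph r = ({..<r}, [{..<r}]\<^bsup>2\<^esup>)"

definition path_graph :: "nat \<Rightarrow> nat graph" where
  "path_graph k = ({..<k}, {{i, Suc i} |i. Suc i < k})"

definition edgeless_graph :: "nat \<Rightarrow> nat graph" where
  "edgeless_graph m = ({..<m}, {})"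

definition star_graph :: "nat \<Rightarrow> nat graph" where
  "star_graph n = ({0..n}, {{0, i} |i. i \<in> {1..n}})"

definition join_graph :: "'a graph \<Rightarrow> 'b graph \<Rightarrow> ('a + 'b) graph" where
  "join_graph G H =
     (verts G <+> verts H,
      (\<lambda>e. Inl ` e) ` edges G \<union> (\<lambda>e. Inr ` e) ` edges H \<union>
      {{Inl u, Inr v} |u v. u \<in> verts G \<and> v \<in> verts H})"

definition book_graph :: "nat \<Rightarrow> (nat + nat) graph" where
  "book_graph m = join_graph (complete_graph 2) (edgeless_graph m)"

text \<open>
  For \<open>k \<le> r\<close> the path on the vertices \<open>0, \<dots>, k - 1\<close> is a subgraph of the complete graph
  on \<open>0, \<dots>, r - 1\<close>; which copy of the path is deleted is irrelevant up to isomorphism.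
\<close>

definition complete_minus_path :: "nat \<Rightarrow> nat \<Rightarrow> nat graph" where
  "complete_minus_path r k = (verts (complete_graph r), edges (complete_graph r) - edges (path_graph k))"

definition ramsey_number :: "'a graph \<Rightarrow> 'b graph \<Rightarrow> nat" where
  "ramsey_number G H = (LEAST r. arrows (complete_graph r) G H)"

text \<open>
  The bound \<open>k \<le> r\<close> makes the set finite. For nonempty finite simple graphs \<open>G\<close> and \<open>H\<close>
  it contains \<open>1\<close>, since a path on one vertex has no edges.
\<close>

definition path_critical_ramsey_number :: "'a graph \<Rightarrow> 'b graph \<Rightarrow> nat" where
  "path_critical_ramsey_number G H =
     (let r = ramsey_number G H
      in Max {k. 1 \<le> k \<and> k \<le> r \<and> arrows (complete_minus_path r k) G H})"

lemma simple_graph_complete: "simple_graph (complete_graph r)"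
  by (simp add: simple_graph_def complete_graph_def)

lemma simple_graph_path: "simple_graph (path_graph k)"
  by (auto simp: simple_graph_def path_graph_def nsets_def)

lemma simple_graph_edgeless: "simple_graph (edgeless_graph m)"
  by (simp add: simple_graph_def edgeless_graph_def)

lemma simple_graph_star: "simple_graph (star_graph n)"
  by (auto simp: simple_graph_def star_graph_def nsets_def)

lemma simple_graph_join:
  assumes "simple_graph G" "simple_graph H"
  shows "simple_graph (join_graph G H)"
proof -
  have "Inl ` e \<in> [verts G <+> verts H]\<^bsup>2\<^esup>" if "e \<in> edges G" for e
  proof -
    have "e \<subseteq> verts G" "finite e" "card e = 2"
      using that assms(1) unfolding simple_graph_def nsets_def by blast+
    then show ?thesis
      unfolding nsets_def by (auto simp: card_image)
  qed
  moreover have "Inr ` e \<in> [verts G <+> verts H]\<^bsup>2\<^esup>" if "e \<in> edges H" for e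
  proof -
    have "e \<subseteq> verts H" "finite e" "card e = 2"
      using that assms(2) unfolding simple_graph_def nsets_def by blast+
    then show ?thesis
      unfolding nsets_def by (auto simp: card_image)
  qed
  moreover have "{{Inl u, Inr v} |u v. u \<in> verts G \<and> v \<in> verts H} \<subseteq> [verts G <+> verts H]\<^bsup>2\<^esup>"
    by auto
  moreover have "finite (verts G <+> verts H)"
    using assms by (simp add: simple_graph_def)
  ultimately show ?thesis
    unfolding simple_graph_def join_graph_def fst_conv snd_conv by blast
qed

lemma simple_graph_book: "simple_graph (book_graph m)"
  by (simp add: book_graph_def simple_graph_join simple_graph_complete simple_graph_edgeless)

lemma simple_graph_complete_minus_path: "simple_graph (complete_minus_path r k)"
  unfolding simple_graph_def complete_minus_path_def complete_graph_def fst_conv snd_conv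
  using finite_lessThan by blast

end

theory Submission
  imports Defs
begin

text \<open>
  Both lower bounds come from colouring the edges inside the two parts of a bipartition red and
  the others blue. For \<open>2n\<close> vertices both parts have size \<open>n\<close>; for \<open>2n + 1\<close> vertices the larger
  part has \<open>n + 1\<close> vertices and is spanned by the deleted path, which lowers every red degree in
  it to at most \<open>n - 1\<close>.

  Conversely, suppose that a colouring of \<open>K\<^bsub>2n+1\<^esub>\<close> minus a path on \<open>n\<close> vertices has no red
  \<open>K\<^bsub>1,n\<^esub>\<close>. Then all blue degrees are at least \<open>n - 1\<close>, and they are at least \<open>n + 1\<close> on the
  \<open>n + 1\<close> vertices off the path. A vertex off the path has a blue neighbour off the path, and two
  such vertices have a common blue neighbour, so there is a blue triangle. Its degree sum is at
  least \<open>3n - 3 \<ge> (2n + 1) + 3m - 2\<close>, so by inclusion-exclusion one of its edges has at least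
  \<open>m\<close> common blue neighbours.
\<close>

section \<open>Neighbourhoods and degrees in the two colours\<close>

definition nbrs :: "'a graph \<Rightarrow> 'a \<Rightarrow> 'a set" where
  "nbrs G v = {w. {v, w} \<in> edges G}"

lemma simple_graph_edgeD:
  assumes "simple_graph G" "{u, v} \<in> edges G"
  shows "u \<noteq> v" "u \<in> verts G" "v \<in> verts G"
proof -
  have "{u, v} \<in> [verts G]\<^bsup>2\<^esup>"
    using assms unfolding simple_graph_def by blast
  then show "u \<noteq> v" "u \<in> verts G" "v \<in> verts G"
    by auto
qed

lemma nbrs_subset:
  assumes "simple_graph G"
  shows "nbrs G v \<subseteq> verts G - {v}"
  using simple_graph_edgeD[OF assms, of v] unfolding nbrs_def by blast

lemma finite_nbrs:
  assumes "simple_graph G"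
  shows "finite (nbrs G v)"
  using nbrs_subset[OF assms] assms finite_subset unfolding simple_graph_def by blast

lemma simple_colour_graph: "simple_graph F \<Longrightarrow> simple_graph (colour_graph F c x)"
  by (auto simp: simple_graph_def colour_graph_def)

lemma verts_colour_graph [simp]: "verts (colour_graph F c x) = verts F"
  by (simp add: colour_graph_def)

text \<open>Once red degrees are below \<open>n\<close>, this turns degrees in \<open>F\<close> into
  lower bounds on blue degrees.\<close>

lemma card_nbrs_colour_graph:
  assumes "simple_graph F"
  shows "card (nbrs F v) =
    card (nbrs (colour_graph F c Red) v) + card (nbrs (colour_graph F c Blue) v)"
proof -
  have "nbrs F v = nbrs (colour_graph F c Red) v \<union> nbrs (colour_graph F c Blue) v"
  proof (rule set_eqI)
    show "w \<in> nbrs F v \<longleftrightarrow>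
      w \<in> nbrs (colour_graph F c Red) v \<union> nbrs (colour_graph F c Blue) v" for w
      by (cases "c {v, w}") (simp_all add: nbrs_def colour_graph_def)
  qed
  moreover have "nbrs (colour_graph F c Red) v \<inter> nbrs (colour_graph F c Blue) v = {}"
    by (auto simp: nbrs_def colour_graph_def)
  ultimately show ?thesis
    using card_Un_disjoint[OF finite_nbrs finite_nbrs, OF simple_colour_graph simple_colour_graph, OF assms assms]
    by metis
qed

section \<open>Stars and books in terms of degrees, triangles and codegrees\<close>

lemma contains_star_imp_degree:
  assumes "simple_graph G" "contains_copy G (star_graph n)"
  obtains v where "v \<in> verts G" "n \<le> card (nbrs G v)"
proof -
  obtain f where f: "inj_on f {0..n}" "f ` {0..n} \<subseteq> verts G"
    and e: "\<forall>e \<in> {{0, i} |i. i \<in> {1..n}}. f ` e \<in> edges G"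
    using assms(2) unfolding contains_copy_def star_graph_def fst_conv snd_conv by blast
  have "f ` {0, i} \<in> edges G" if "i \<in> {1..n}" for i
    using e that by blast
  then have "f ` {1..n} \<subseteq> nbrs G (f 0)"
    by (auto simp: nbrs_def)
  moreover have "inj_on f {1..n}"
    using f(1) by (rule inj_on_subset) auto
  then have "card (f ` {1..n}) = n"
    by (simp add: card_image)
  ultimately have "n \<le> card (nbrs G (f 0))"
    using card_mono[OF finite_nbrs[OF assms(1)]] by metis
  moreover have "f 0 \<in> verts G"
    using f(2) by auto
  ultimately show thesis
    by (rule that[rotated])
qed

lemma contains_star_if_degree:
  assumes "simple_graph G" "v \<in> verts G" "n \<le> card (nbrs G v)"
  shows "contains_copy G (star_graph n)"
proof -
  obtain T where T: "T \<subseteq> nbrs G v" "card T = n" "finite T"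
    using obtain_subset_with_card_n[OF assms(3)] by metis
  obtain h where h: "bij_betw h {1..n} T"
    using ex_bij_betw_nat_finite_1[OF T(3)] T(2) by auto
  define f where "f = h(0 := v)"
  have hT: "h i \<in> nbrs G v" if "i \<in> {1..n}" for i
    using h T(1) that by (auto simp: bij_betw_def)
  have "{0..n} = insert 0 {1..n}"
    by auto
  moreover have "bij_betw f {1..n} T"
    \<comment> \<open>The update at \<open>0\<close> does not touch \<open>{1..n}\<close>, so
      \<open>f\<close> and \<open>h\<close> agree there.\<close>
    using h by (rule iffD1[OF bij_betw_cong, rotated]) (simp add: f_def)
  then have "inj_on f {1..n}" "f ` {1..n} = T"
    by (simp_all add: bij_betw_def)
  moreover have f0: "f 0 = v"
    by (simp add: f_def)
  moreover have "v \<notin> T"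
    using T(1) nbrs_subset[OF assms(1), of v] by blast
  ultimately have "inj_on f {0..n}" "f ` {0..n} = insert v T"
    by simp_all
  moreover have "insert v T \<subseteq> verts G"
    using T(1) nbrs_subset[OF assms(1), of v] assms(2) by auto
  moreover have "f ` {0, i} \<in> edges G" if "i \<in> {1..n}" for i
  proof -
    have "f ` {0, i} = {v, h i}"
      using that by (auto simp: f_def)
    then show ?thesis
      using hT[OF that] by (simp add: nbrs_def)
  qed
  ultimately show ?thesis
    unfolding contains_copy_def star_graph_def fst_conv snd_conv
    by (intro exI[of _ f]) blast
qed

lemma edges_complete_graph_2: "edges (complete_graph 2) = {{0, 1}}"
proof -
  have "{..<2::nat} = {0, 1}"
    by auto
  then show ?thesis
    by (auto simp: complete_graph_def nsets_def card_2_iff)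
qed

text \<open>The spine together with one page is a triangle; \<open>1 \<le> m\<close> supplies the
  page \<open>Inr 0\<close>.\<close>

lemma contains_book_imp_triangle:
  assumes "contains_copy G (book_graph m)" "1 \<le> m"
  obtains u v w where "v \<in> nbrs G u" "w \<in> nbrs G u" "w \<in> nbrs G v"
proof -
  obtain f where f: "\<And>e. e \<in> edges (book_graph m) \<Longrightarrow> f ` e \<in> edges G"
    using assms(1) unfolding contains_copy_def by auto
  have "Inl ` {0, 1} \<in> edges (book_graph m)"
    unfolding book_graph_def join_graph_def edges_complete_graph_2 snd_conv by blast
  moreover have "{Inl i, Inr 0} \<in> edges (book_graph m)" if "i < 2" for i
    using that assms(2)
    unfolding book_graph_def join_graph_def complete_graph_def edgeless_graph_def snd_conv fst_conv
    by (intro UnI2 CollectI exI[of _ i] exI[of _ 0]) simp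
  ultimately have "f ` (Inl ` {0, 1}) \<in> edges G" "f ` {Inl 0, Inr 0} \<in> edges G"
    "f ` {Inl 1, Inr 0} \<in> edges G"
    using f by (metis zero_less_numeral one_less_numeral_iff semiring_norm(76))+
  then show thesis
    using that[of "f (Inl 1)" "f (Inl 0)" "f (Inr 0)"] by (simp add: nbrs_def)
qed

lemma contains_book_if_codegree:
  assumes "simple_graph G" "v \<in> nbrs G u" "m \<le> card (nbrs G u \<inter> nbrs G v)"
  shows "contains_copy G (book_graph m)"
proof -
  obtain T where T: "T \<subseteq> nbrs G u \<inter> nbrs G v" "card T = m" "finite T"
    using obtain_subset_with_card_n[OF assms(3)] by metis
  obtain h where h: "bij_betw h {..<m} T"
    using ex_bij_betw_nat_finite[OF T(3)] T(2) by (auto simp: atLeast0LessThan)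
  have uv: "{u, v} \<in> edges G" "u \<noteq> v" "u \<in> verts G" "v \<in> verts G"
    using assms(2) simple_graph_edgeD[OF assms(1), of u v] by (auto simp: nbrs_def)
  have hT: "h i \<in> nbrs G u" "h i \<in> nbrs G v" "h i \<noteq> u" "h i \<noteq> v" "h i \<in> verts G" if "i < m" for i
  proof -
    have "h i \<in> T"
      using h that by (auto simp: bij_betw_def)
    then show "h i \<in> nbrs G u" "h i \<in> nbrs G v" "h i \<noteq> u" "h i \<noteq> v" "h i \<in> verts G"
      using T(1) nbrs_subset[OF assms(1), of u] nbrs_subset[OF assms(1), of v] by auto
  qed
  \<comment> \<open>The spine (left summand) goes to \<open>u\<close>, \<open>v\<close> and the
    pages (right summand) go to \<open>T\<close>.\<close>
  define f where "f = case_sum (\<lambda>i::nat. if i = 0 then u else v) h"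
  have verts: "verts (book_graph m) = {..<2} <+> {..<m}"
    by (simp add: book_graph_def join_graph_def complete_graph_def edgeless_graph_def)
  have "inj_on f (verts (book_graph m))"
  proof (rule inj_onI)
    fix x y assume *: "x \<in> verts (book_graph m)" "y \<in> verts (book_graph m)" "f x = f y"
    have "inj_on h {..<m}"
      using h by (rule bij_betw_imp_inj_on)
    then show "x = y"
      using * uv(2) hT(3,4) hT(3,4)[symmetric] unfolding verts
      by (cases x; cases y) (auto simp: f_def inj_on_def less_2_cases_iff split: if_splits)
  qed
  moreover have "f ` verts (book_graph m) \<subseteq> verts G"
    unfolding verts using uv hT by (auto simp: f_def)
  moreover have "f ` e \<in> edges G" if "e \<in> edges (book_graph m)" for e
  proof -
    from that consider "e = Inl ` {0, 1}" | i j where "i < 2" "j < m" "e = {Inl i, Inr j}"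
      unfolding book_graph_def join_graph_def edges_complete_graph_2
      by (auto simp: complete_graph_def edgeless_graph_def)
    then show ?thesis
      using uv hT by cases (auto simp: f_def nbrs_def)
  qed
  ultimately show ?thesis
    unfolding contains_copy_def by blast
qed

text \<open>The degree sum is at most the number of vertices plus the three codegrees. If all
  codegrees were at most \<open>m - 1\<close>, it would be at most
  \<open>card (verts G) + 3 * m - 3\<close>, one short of \<open>sum\<close>.\<close>

lemma contains_book_if_triangle:
  assumes "simple_graph G"
    and triangle: "v \<in> nbrs G u" "w \<in> nbrs G u" "w \<in> nbrs G v"
    and sum: "card (verts G) + 3 * m \<le> card (nbrs G u) + card (nbrs G v) + card (nbrs G w) + 2"
  shows "contains_copy G (book_graph m)"
proof -
  let ?A = "nbrs G u" and ?B = "nbrs G v" and ?C = "nbrs G w"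
  have fin: "finite ?A" "finite ?B" "finite ?C" "finite (verts G)"
    using assms(1) by (simp_all add: finite_nbrs simple_graph_def)
  have "card ?A + card ?B = card (?A \<union> ?B) + card (?A \<inter> ?B)"
    by (rule card_Un_Int) (simp_all add: fin)
  moreover have "card (?A \<union> ?B) + card ?C = card (?A \<union> ?B \<union> ?C) + card ((?A \<union> ?B) \<inter> ?C)"
    by (rule card_Un_Int) (simp_all add: fin)
  moreover have "card ((?A \<union> ?B) \<inter> ?C) \<le> card (?A \<inter> ?C) + card (?B \<inter> ?C)"
    unfolding Int_Un_distrib2 by (rule card_Un_le)
  moreover have "card (?A \<union> ?B \<union> ?C) \<le> card (verts G)"
    by (rule card_mono[OF fin(4)]) (use nbrs_subset[OF assms(1)] in blast)
  ultimately have "m \<le> card (?A \<inter> ?B) \<or> m \<le> card (?A \<inter> ?C) \<or> m \<le> card (?B \<inter> ?C)"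
    using sum by linarith
  then show ?thesis
    using contains_book_if_codegree[OF assms(1)] triangle by blast
qed

section \<open>Lower bounds from bipartite blue graphs\<close>

lemma not_arrows_bipartition:
  assumes "simple_graph F" "1 \<le> m"
    and deg: "\<And>v. v \<in> verts F \<Longrightarrow> card {w \<in> nbrs F v. w \<in> A \<longleftrightarrow> v \<in> A} < n"
  shows "\<not> arrows F (star_graph n) (book_graph m)"
proof -
  define c where "c e = (if e \<subseteq> A \<or> e \<inter> A = {} then Red else Blue)" for e
  have red: "nbrs (colour_graph F c Red) v = {w \<in> nbrs F v. w \<in> A \<longleftrightarrow> v \<in> A}" for v
    by (auto simp: nbrs_def colour_graph_def c_def split: if_splits)
  have blue: "nbrs (colour_graph F c Blue) v = {w \<in> nbrs F v. w \<in> A \<longleftrightarrow> v \<notin> A}" for v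
    by (auto simp: nbrs_def colour_graph_def c_def)
  have "\<not> contains_copy (colour_graph F c Red) (star_graph n)"
  proof
    assume "contains_copy (colour_graph F c Red) (star_graph n)"
    then obtain v where "v \<in> verts F" "n \<le> card (nbrs (colour_graph F c Red) v)"
      using contains_star_imp_degree[OF simple_colour_graph[OF assms(1)]]
      by (metis verts_colour_graph)
    then show False
      using deg[of v] by (simp add: red)
  qed
  moreover have "\<not> contains_copy (colour_graph F c Blue) (book_graph m)"
  proof
    assume "contains_copy (colour_graph F c Blue) (book_graph m)"
    then obtain u v w where "v \<in> nbrs (colour_graph F c Blue) u"
      "w \<in> nbrs (colour_graph F c Blue) u" "w \<in> nbrs (colour_graph F c Blue) v"
      using contains_book_imp_triangle assms(2) by metis
    \<comment> \<open>The three corners would lie pairwise on opposite sides of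
      \<open>A\<close>.\<close>
    then show False
      unfolding blue by auto
  qed
  ultimately show ?thesis
    unfolding arrows_def by blast
qed

lemma verts_complete_minus_path [simp]: "verts (complete_minus_path r k) = {..<r}"
  by (simp add: complete_minus_path_def complete_graph_def)

lemma nbrs_complete_minus_path:
  "nbrs (complete_minus_path r k) v =
     {w. v < r \<and> w < r \<and> w \<noteq> v \<and> \<not> (w = Suc v \<and> w < k) \<and> \<not> (v = Suc w \<and> v < k)}"
proof -
  have "{v, w} \<in> edges (path_graph k) \<longleftrightarrow> (w = Suc v \<and> w < k) \<or> (v = Suc w \<and> v < k)" for w
    by (auto simp: path_graph_def doubleton_eq_iff)
  moreover have "{v, w} \<in> edges (complete_graph r) \<longleftrightarrow> v < r \<and> w < r \<and> w \<noteq> v" for w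
    by (auto simp: complete_graph_def)
  ultimately show ?thesis
    unfolding nbrs_def complete_minus_path_def snd_conv Diff_iff by blast
qed

text \<open>This makes the bounds for the Ramsey number instances of statements about deleted
  paths.\<close>

lemma complete_minus_path_1: "complete_minus_path r 1 = complete_graph r"
  by (simp add: complete_minus_path_def path_graph_def)

lemma not_arrows_complete:
  assumes "1 \<le> m" "1 \<le> n" "r \<le> 2 * n"
  shows "\<not> arrows (complete_graph r) (star_graph n) (book_graph m)"
  unfolding complete_minus_path_1[symmetric]
proof (rule not_arrows_bipartition[OF simple_graph_complete_minus_path assms(1), where A = "{..<n}"])
  fix v assume "v \<in> verts (complete_minus_path r 1)"
  then have v: "v < r"
    by simp
  let ?D = "{w \<in> nbrs (complete_minus_path r 1) v. w \<in> {..<n} \<longleftrightarrow> v \<in> {..<n}}"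
  \<comment> \<open>The comparison is with full blocks of \<open>n\<close> labels, which covers
    \<open>r < 2 * n\<close> as well.\<close>
  have "?D \<subseteq> (if v < n then {..<n} - {v} else {n..<2 * n} - {v})"
    using assms(3) by (auto simp: nbrs_complete_minus_path)
  then have "card ?D \<le> card (if v < n then {..<n} - {v} else {n..<2 * n} - {v})"
    by (rule card_mono[rotated]) auto
  also have "\<dots> = n - 1"
    using v assms(3) by auto
  finally show "card ?D < n"
    using assms(2) by linarith
qed

lemma not_arrows_complete_minus_path:
  assumes "1 \<le> m" "1 \<le> n" "n < k"
  shows "\<not> arrows (complete_minus_path (2 * n + 1) k) (star_graph n) (book_graph m)"
proof (rule not_arrows_bipartition[OF simple_graph_complete_minus_path assms(1), where A = "{..n}"])
  fix v assume "v \<in> verts (complete_minus_path (2 * n + 1) k)"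
  then have v: "v < 2 * n + 1"
    by simp
  let ?D = "{w \<in> nbrs (complete_minus_path (2 * n + 1) k) v. w \<in> {..n} \<longleftrightarrow> v \<in> {..n}}"
  \<comment> \<open>For \<open>v \<le> n\<close> this is a path neighbour of \<open>v\<close> inside
    \<open>{..n}\<close>: the successor, or the predecessor at the end \<open>v = n\<close>. As
    \<open>n < k\<close>, the edge to it is deleted.\<close>
  define v' where "v' = (if v < n then Suc v else v - 1)"
  let ?E = "if v \<le> n then {..n} - {v, v'} else {n + 1..2 * n} - {v}"
  have "?D \<subseteq> ?E"
    using assms by (auto simp: nbrs_complete_minus_path v'_def)
  then have "card ?D \<le> card ?E"
    by (rule card_mono[rotated]) auto
  also have "card ?E = n - 1"
  proof (cases "v \<le> n")
    case True
    then have "{v, v'} \<subseteq> {..n}" "card {v, v'} = 2"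
      using assms(2) by (auto simp: v'_def)
    with True show ?thesis
      by (simp add: card_Diff_subset)
  next
    case False
    with v show ?thesis
      by simp
  qed
  finally show "card ?D < n"
    using assms(2) by linarith
qed

section \<open>Upper bound: a blue triangle of large degree sum\<close>

lemma arrows_complete_minus_path:
  assumes "n \<ge> 3 * m + 2" "k \<le> n"
  shows "arrows (complete_minus_path (2 * n + 1) k) (star_graph n) (book_graph m)"
  unfolding arrows_def
proof
  fix c
  let ?F = "complete_minus_path (2 * n + 1) k"
  let ?R = "colour_graph ?F c Red" and ?B = "colour_graph ?F c Blue"
  have simple: "simple_graph ?F" "simple_graph ?R" "simple_graph ?B"
    by (simp_all add: simple_graph_complete_minus_path simple_colour_graph)
  show "contains_copy ?R (star_graph n) \<or> contains_copy ?B (book_graph m)"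
  proof (cases "contains_copy ?R (star_graph n)")
    case no_star: False
    have red: "card (nbrs ?R v) < n" if "v < 2 * n + 1" for v
      using contains_star_if_degree[OF simple(2), of v n] no_star that by force
    have split: "card (nbrs ?F v) = card (nbrs ?R v) + card (nbrs ?B v)" for v
      by (rule card_nbrs_colour_graph[OF simple(1)])
    have deg: "n - 1 \<le> card (nbrs ?B v)" if "v < 2 * n + 1" for v
    proof -
      \<comment> \<open>Only \<open>v\<close> and its possible path neighbours are excluded. At
        \<open>v = 0\<close> the truncated \<open>v - 1\<close> is \<open>v\<close> itself, which is
        harmless.\<close>
      have "{..<2 * n + 1} - {v, Suc v, v - 1} \<subseteq> nbrs ?F v"
        using that by (auto simp: nbrs_complete_minus_path)
      then have "card ({..<2 * n + 1} - {v, Suc v, v - 1}) \<le> card (nbrs ?F v)"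
        by (rule card_mono[OF finite_nbrs[OF simple(1)]])
      moreover have "card {..<2 * n + 1} - card {v, Suc v, v - 1} \<le>
          card ({..<2 * n + 1} - {v, Suc v, v - 1})"
        by (rule diff_card_le_card_Diff) simp
      moreover have "card {v, Suc v, v - 1} \<le> 3"
        by (simp add: card_insert_if)
      ultimately have "2 * n - 2 \<le> card (nbrs ?F v)"
        by simp
      then show ?thesis
        using split[of v] red[OF that] by linarith
    qed
    have deg_off: "n + 1 \<le> card (nbrs ?B v)" if "v < 2 * n + 1" "n \<le> v" for v
    proof -
      \<comment> \<open>Since \<open>k \<le> n \<le> v\<close>, the vertex \<open>v\<close> is off
        the path and no edge at it is deleted.\<close>
      have "nbrs ?F v = {..<2 * n + 1} - {v}"
        using that assms(2) by (auto simp: nbrs_complete_minus_path)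
      then have "card (nbrs ?F v) = 2 * n"
        using that(1) by simp
      then show ?thesis
        using split[of v] red[OF that(1)] by linarith
    qed
    have sub: "nbrs ?B v \<subseteq> {..<2 * n + 1}" for v
      using nbrs_subset[OF simple(3), of v] by auto
    \<comment> \<open>The vertex \<open>2 * n\<close> is off the path, so its \<open>n + 1\<close>
      blue neighbours cannot all have labels below \<open>n\<close>. A neighbour
      \<open>v \<ge> n\<close> is again off the path.\<close>
    have "\<not> nbrs ?B (2 * n) \<subseteq> {..<n}"
    proof
      assume "nbrs ?B (2 * n) \<subseteq> {..<n}"
      then have "card (nbrs ?B (2 * n)) \<le> n"
        using card_mono[of "{..<n}"] by fastforce
      with deg_off[of "2 * n"] show False
        by simp
    qed
    then obtain v where v: "v \<in> nbrs ?B (2 * n)" "n \<le> v" "v < 2 * n + 1"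
      using sub by (meson lessThan_iff not_less subset_iff)
    \<comment> \<open>Disjoint neighbourhoods would need \<open>2 * n + 2\<close> vertices.\<close>
    have "nbrs ?B (2 * n) \<inter> nbrs ?B v \<noteq> {}"
    proof
      assume "nbrs ?B (2 * n) \<inter> nbrs ?B v = {}"
      then have "card (nbrs ?B (2 * n) \<union> nbrs ?B v) = card (nbrs ?B (2 * n)) + card (nbrs ?B v)"
        by (rule card_Un_disjoint[OF finite_nbrs finite_nbrs, OF simple(3) simple(3)])
      moreover have "card (nbrs ?B (2 * n) \<union> nbrs ?B v) \<le> card {..<2 * n + 1}"
        using sub by (intro card_mono) auto
      ultimately show False
        using deg_off[of "2 * n"] deg_off[OF v(3,2)] by simp
    qed
    then obtain w where w: "w \<in> nbrs ?B (2 * n)" "w \<in> nbrs ?B v"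
      by auto
    then have "w < 2 * n + 1"
      using sub by blast
    \<comment> \<open>The corner \<open>w\<close> may be on the path. With \<open>n - 1\<close> at
      each corner, the required \<open>2 * n + 1 + 3 * m \<le> 3 * (n - 1) + 2\<close> is exactly
      \<open>n \<ge> 3 * m + 2\<close>.\<close>
    then have "contains_copy ?B (book_graph m)"
      using contains_book_if_triangle[OF simple(3) v(1) w, of m] assms(1)
        deg[of "2 * n"] deg[OF v(3)] deg[of w] by simp
    then show ?thesis ..
  qed simp
qed

theorem theorem2:
  fixes m n :: nat
  assumes "m \<ge> 2" and "n \<ge> 3 * m + 2"
  shows "path_critical_ramsey_number (star_graph n) (book_graph m) = n"
proof -
  have "ramsey_number (star_graph n) (book_graph m) = 2 * n + 1"
    unfolding ramsey_number_def
  proof (rule Least_equality)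
    show "arrows (complete_graph (2 * n + 1)) (star_graph n) (book_graph m)"
      \<comment> \<open>A path on one vertex deletes nothing.\<close>
      using arrows_complete_minus_path[of m n 1] assms(2) unfolding complete_minus_path_1 by simp
  next
    fix r assume "arrows (complete_graph r) (star_graph n) (book_graph m)"
    then show "2 * n + 1 \<le> r"
      using not_arrows_complete[of m n r] assms by force
  qed
  \<comment> \<open>Every \<open>k \<le> n\<close> arrows, and every \<open>k > n\<close> fails by
    the bipartite colouring.\<close>
  moreover have "{k. 1 \<le> k \<and> k \<le> 2 * n + 1 \<and>
      arrows (complete_minus_path (2 * n + 1) k) (star_graph n) (book_graph m)} = {1..n}"
    using arrows_complete_minus_path[OF assms(2)] not_arrows_complete_minus_path[of m n] assms
    by (auto simp: not_less[symmetric])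
  moreover have "Max {1..n} = n"
    using assms(2) by (intro Max_eqI) auto
  ultimately show ?thesis
    unfolding path_critical_ramsey_number_def Let_def by simp
qed

end
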